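(* Let $O_n$ be the chain of $n$ squares in which consecutive contact vertices are adjacent. Then: (i) for every $n\geq 2$ and $k\geq 1$, if $n=2k$, then $$ABC_{GG}(O_n)=2k\sqrt{2}+4\left(\sum_{i=1}^{k}\sqrt{\frac{6k-1}{(6k-3i+2)(3i-1)}}\right),$$ and if $n=2k+1$, then $$ABC_{GG}(O_n)=(2k+1)\sqrt{2}+\frac{2\sqrt{6k+2}}{3k+2}+4\left(\sum_{i=1}^{k}\sqrt{\frac{6k+2}{(6k-3i+5)(3i-1)}}\right);$$ (ii) for every $n\geq 2$, $$ABC(O_n)=\frac{3n+2}{\sqrt{2}}+\frac{(n-2)\sqrt{6}}{4}.$$
   Context: For a finite simple graph $G$, $ABC(G)=\sum_{uv\in E(G)}\sqrt{\frac{d_u+d_v-2}{d_ud_v}}$, where $d_u$ is the degree of $u$ in $G$. For an edge $uv$ of $G$, $n_u(uv,G)$ is the number of vertices of $G$ strictly closer to $u$ than to $v$, and $n_v(uv,G)$ is defined analogously; equidistant vertices are not counted. $ABC_{GG}(G)=\sum_{uv\in E(G)}\sqrt{\frac{n_u(uv,G)+n_v(uv,G)-2}{n_u(uv,G)n_v(uv,G)}}$. The graph $O_n$ (of order $n$) is defined as follows: take $n$ disjoint 4-cycles, choose in the $i$-th one two adjacent vertices $w_i,v_i$, and identify $v_i$ with $w_{i+1}$ for $i=1,\ldots,n-1$. *)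

theory Defs
  imports Complex_Main "HOL-Library.Extended_Nat"
begin

record 'a graph =
  verts :: "'a set"
  edges :: "'a set set"

definition finite_simple_graph :: "'a graph \<Rightarrow> bool" where
  "finite_simple_graph G \<longleftrightarrow>
     finite (verts G) \<and> (\<forall>e\<in>edges G. e \<subseteq> verts G \<and> card e = 2)"

definition degree :: "'a graph \<Rightarrow> 'a \<Rightarrow> nat" where
  "degree G u = card {e \<in> edges G. u \<in> e}"

definition adj_rel :: "'a graph \<Rightarrow> 'a rel" where
  "adj_rel G = {(u, v). {u, v} \<in> edges G}"

text \<open>
  A pair is in the \<open>n\<close>-th relational power of adjacency iff it is joined by a walk of length
  \<open>n\<close>; the distance is \<open>\<infinity>\<close> if there is no walk at all.
\<close>
definition graph_dist :: "'a graph \<Rightarrow> 'a \<Rightarrow> 'a \<Rightarrow> enat" where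
  "graph_dist G u v = (INF n \<in> {n. (u, v) \<in> adj_rel G ^^ n}. enat n)"

text \<open>\<open>n_closer G u v\<close> is the number written $n_u(uv,G)$, so $n_v(uv,G)$ is \<open>n_closer G v u\<close>.\<close>
definition n_closer :: "'a graph \<Rightarrow> 'a \<Rightarrow> 'a \<Rightarrow> nat" where
  "n_closer G u v = card {x \<in> verts G. graph_dist G x u < graph_dist G x v}"

text \<open>
  Edges are two-element sets \<open>e = {u, v}\<close>, so the sums and products over \<open>u \<in> e\<close> below are
  the sums and products of the two end-vertex quantities; in the second index \<open>v\<close> ranges
  over the single other end of \<open>e\<close>. See \<open>ABC_summand\<close> and \<open>ABC_GG_summand\<close>.
\<close>
definition ABC :: "'a graph \<Rightarrow> real" where
  "ABC G = (\<Sum>e\<in>edges G.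
     sqrt (((\<Sum>u\<in>e. real (degree G u)) - 2) / (\<Prod>u\<in>e. real (degree G u))))"

definition ABC_GG :: "'a graph \<Rightarrow> real" where
  "ABC_GG G = (\<Sum>e\<in>edges G.
     sqrt (((\<Sum>u\<in>e. \<Sum>v\<in>e - {u}. real (n_closer G u v)) - 2) /
           (\<Prod>u\<in>e. \<Prod>v\<in>e - {u}. real (n_closer G u v))))"

lemma ABC_summand:
  assumes "u \<noteq> v" and "e = {u, v}"
  shows "sqrt (((\<Sum>u\<in>e. real (degree G u)) - 2) / (\<Prod>u\<in>e. real (degree G u))) =
    sqrt ((real (degree G u) + real (degree G v) - 2) / (real (degree G u) * real (degree G v)))"
  using assms by simp

lemma ABC_GG_summand:
  assumes "u \<noteq> v" and "e = {u, v}"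
  shows "sqrt (((\<Sum>u\<in>e. \<Sum>v\<in>e - {u}. real (n_closer G u v)) - 2) /
           (\<Prod>u\<in>e. \<Prod>v\<in>e - {u}. real (n_closer G u v))) =
    sqrt ((real (n_closer G u v) + real (n_closer G v u) - 2) /
           (real (n_closer G u v) * real (n_closer G v u)))"
proof -
  have "{u, v} - {u} = {v}" "{u, v} - {v} = {u}"
    using assms by auto
  then show ?thesis
    using assms by simp
qed

text \<open>
  The vertices \<open>(i, 0), (i, 1), (i, 2), (i, 3)\<close>, in this cyclic order, form the \<open>i\<close>-th 4-cycle.
\<close>
definition disjoint_squares :: "nat \<Rightarrow> (nat \<times> nat) graph" where
  "disjoint_squares n =
     \<lparr>verts = {1..n} \<times> {0..<4},
      edges = {{(i, j), (i, (j + 1) mod 4)} | i j. i \<in> {1..n} \<and> j < 4}\<rparr>"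

definition image_graph :: "('a \<Rightarrow> 'b) \<Rightarrow> 'a graph \<Rightarrow> 'b graph" where
  "image_graph f G = \<lparr>verts = f ` verts G, edges = (\<lambda>e. f ` e) ` edges G\<rparr>"

text \<open>
  In the \<open>i\<close>-th square the chosen adjacent vertices are $w_i$ = \<open>(i, 0)\<close> and $v_i$ = \<open>(i, 1)\<close>.
  Each identified pair $v_i = w_{i+1}$ is represented by $w_{i+1}$; other vertices stay fixed.
\<close>
definition contact :: "nat \<Rightarrow> nat \<times> nat \<Rightarrow> nat \<times> nat" where
  "contact n = (\<lambda>(i, j). if j = 1 \<and> i < n then (i + 1, 0) else (i, j))"

definition ortho_chain :: "nat \<Rightarrow> (nat \<times> nat) graph" where
  "ortho_chain n = image_graph (contact n) (disjoint_squares n)"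

lemma finite_simple_graph_ortho_chain: "finite_simple_graph (ortho_chain n)"
proof -
  have "card (contact n ` e) = 2" "contact n ` e \<subseteq> contact n ` ({1..n} \<times> {0..<4})"
    if e: "e \<in> edges (disjoint_squares n)" for e
  proof -
    from e obtain i j where ij: "i \<in> {1..n}" "j < 4" "e = {(i, j), (i, (j + 1) mod 4)}"
      by (auto simp: disjoint_squares_def)
    from ij(2) consider "j = 0" | "j = 1" | "j = 2" | "j = 3" by linarith
    then show "card (contact n ` e) = 2"
      by cases (auto simp: ij(3) contact_def)
    show "contact n ` e \<subseteq> contact n ` ({1..n} \<times> {0..<4})"
      using ij by (intro image_mono) auto
  qed
  then show ?thesis
    unfolding finite_simple_graph_def ortho_chain_def image_graph_def
    by (auto simp: disjoint_squares_def)
qed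

end

theory Submission
  imports Defs
begin

text \<open>
  The chain is a backbone path \<open>p\<^sub>0, \<dots>, p\<^sub>n\<close> whose \<open>i\<close>-th edge \<open>p\<^sub>i\<^sub>-\<^sub>1p\<^sub>i\<close> is also the
  bottom of a square with top corners \<open>a\<^sub>i\<close> above \<open>p\<^sub>i\<^sub>-\<^sub>1\<close> and \<open>b\<^sub>i\<close> above \<open>p\<^sub>i\<close>. In coordinates,
  \<open>p\<^sub>i\<^sub>-\<^sub>1 = (i, 0)\<close>, \<open>p\<^sub>i = contact n (i, 1)\<close>, \<open>b\<^sub>i = (i, 2)\<close> and \<open>a\<^sub>i = (i, 3)\<close>. There are
  \<open>3n + 1\<close> vertices.

  For \<open>ABC\<close> only degrees matter. All vertices have degree 2 except the inner \<open>p\<^sub>i\<close>, which have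
  degree 4. An edge with an end of degree 2 contributes \<open>1 / sqrt 2\<close> whatever its other end
  is; this applies to all \<open>4n\<close> edges except the \<open>n - 2\<close> inner backbone edges, which
  contribute \<open>sqrt (6 / 16)\<close> each.

  For \<open>ABC_GG\<close>, opposite sides of a square define the same cut of the chain. The sides
  \<open>p\<^sub>i\<^sub>-\<^sub>1p\<^sub>i\<close> and \<open>a\<^sub>ib\<^sub>i\<close> separate the \<open>3i - 1\<close> vertices on the left from the other
  \<open>3n - 3i + 2\<close>; the sides \<open>p\<^sub>i\<^sub>-\<^sub>1a\<^sub>i\<close> and \<open>p\<^sub>ib\<^sub>i\<close> separate \<open>{a\<^sub>i, b\<^sub>i}\<close> from everything else.
  In each case the vertices closer to one end of the edge are exactly those on its side of
  the cut, so a transverse side contributes \<open>1 / sqrt 2\<close> again and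
  \<open>ABC_GG = n sqrt 2 + 2 (t\<^sub>1 + \<dots> + t\<^sub>n)\<close> with \<open>t\<^sub>i\<close> the contribution of a parallel side. Reflecting the
  chain gives \<open>t\<^sub>n\<^sub>+\<^sub>1\<^sub>-\<^sub>i = t\<^sub>i\<close>, and pairing these terms yields the two formulas, the odd
  one with an unpaired middle term.

  That a cut determines which vertices are closer is shown without computing any distance:
  each part is the image of a folding of the graph that collapses the cut edges
  (\<open>folded_walk\<close>, \<open>n_closer_of_folds\<close>), so a walk crossing the cut to one end of a cut
  edge folds to a shorter walk to the other end.
\<close>

section \<open>Counting closer vertices by folding a graph along a cut\<close>

text \<open>
  The map \<open>r\<close> is a retraction that sends every edge to an edge or to a single vertex, and it
  must collapse the edges that leave \<open>S\<close>. The condition on edges is phrased symmetrically in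
  \<open>x\<close> and \<open>y\<close> so that it need be checked for one orientation of each edge only.
\<close>
definition folds_onto :: "'a graph \<Rightarrow> 'a set \<Rightarrow> ('a \<Rightarrow> 'a) \<Rightarrow> bool" where
  "folds_onto G S r \<longleftrightarrow>
     (\<forall>x\<in>S. r x = x) \<and>
     (\<forall>x y. {x, y} \<in> edges G \<longrightarrow>
        r x = r y \<or> ({r x, r y} \<in> edges G \<and> (x \<in> S \<longleftrightarrow> y \<in> S)))"

text \<open>
  Applying \<open>r\<close> to a walk and deleting the collapsed steps does not lengthen it. A walk that
  starts in \<open>S\<close> and ends outside has to leave \<open>S\<close>, and the step where it does is collapsed,
  which makes the inequality strict.
\<close>
lemma folded_walk:
  assumes "folds_onto G S r" "x \<in> S" "(x, y) \<in> adj_rel G ^^ n"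
  shows "\<exists>m\<le>n. (x, r y) \<in> adj_rel G ^^ m \<and> (y \<notin> S \<longrightarrow> m < n)"
  using assms(3)
proof (induction n arbitrary: y)
  case 0
  then show ?case using assms(1,2) by (auto simp: folds_onto_def)
next
  case (Suc n)
  then obtain z where z: "(x, z) \<in> adj_rel G ^^ n" "{z, y} \<in> edges G"
    by (auto simp: adj_rel_def)
  from Suc.IH[OF z(1)] obtain m where
    m: "m \<le> n" "(x, r z) \<in> adj_rel G ^^ m" "z \<notin> S \<longrightarrow> m < n"
    by blast
  from assms(1) z(2) consider "r z = r y"
    | "{r z, r y} \<in> edges G" "z \<in> S \<longleftrightarrow> y \<in> S"
    by (auto simp: folds_onto_def)
  then show ?case
  proof cases
    case 1
    then show ?thesis using m by (intro exI[of _ m]) auto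
  next
    case 2
    then have "(x, r y) \<in> adj_rel G ^^ Suc m"
      using m(2) by (auto simp: adj_rel_def)
    then show ?thesis using m 2(2) by (intro exI[of _ "Suc m"]) auto
  qed
qed

lemma graph_dist_attained:
  assumes "(x, y) \<in> (adj_rel G)\<^sup>*"
  obtains n where "(x, y) \<in> adj_rel G ^^ n" "graph_dist G x y = enat n"
proof -
  let ?A = "enat ` {n. (x, y) \<in> adj_rel G ^^ n}"
  have ne: "?A \<noteq> {}" using assms by (auto simp: rtrancl_power)
  then have "Inf ?A \<in> ?A"
    unfolding Inf_enat_def by (auto intro: LeastI)
  then show thesis using that unfolding graph_dist_def by blast
qed

lemma folds_onto_imp_closer:
  assumes "folds_onto G S r" "x \<in> S" "v \<notin> S" "(x, v) \<in> (adj_rel G)\<^sup>*"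
  shows "graph_dist G x (r v) < graph_dist G x v"
proof -
  from assms(4) obtain n where
    n: "(x, v) \<in> adj_rel G ^^ n" "graph_dist G x v = enat n"
    by (rule graph_dist_attained)
  from folded_walk[OF assms(1,2) n(1)] assms(3) obtain m where
    m: "m < n" "(x, r v) \<in> adj_rel G ^^ m"
    by blast
  have "graph_dist G x (r v) \<le> enat m"
    unfolding graph_dist_def using m(2) by (auto intro: INF_lower)
  also have "\<dots> < enat n" using m(1) by simp
  finally show ?thesis using n(2) by simp
qed

text \<open>
  Folding onto the part of \<open>u\<close> shows that this part is closer to \<open>u\<close>, folding onto the other
  part that the rest is closer to \<open>v\<close>. Connectedness excludes vertices at infinite distance
  from both ends.
\<close>
lemma n_closer_of_folds:
  assumes connected: "\<And>x y. x \<in> verts G \<Longrightarrow> y \<in> verts G \<Longrightarrow> (x, y) \<in> (adj_rel G)\<^sup>*"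
    and folds: "folds_onto G S r" "folds_onto G (- S) r'"
    and ends: "u \<in> verts G" "u \<in> S" "v \<in> verts G" "v \<notin> S" "r v = u" "r' u = v"
  shows "n_closer G u v = card (verts G \<inter> S)"
    and "n_closer G v u = card (verts G - S)"
proof -
  have S: "graph_dist G x u < graph_dist G x v" if "x \<in> verts G" "x \<in> S" for x
    using folds_onto_imp_closer[OF folds(1), of x v] connected that ends by auto
  have S': "graph_dist G x v < graph_dist G x u" if "x \<in> verts G" "x \<notin> S" for x
    using folds_onto_imp_closer[OF folds(2), of x u] connected that ends by auto
  have "{x \<in> verts G. graph_dist G x u < graph_dist G x v} = verts G \<inter> S"
    "{x \<in> verts G. graph_dist G x v < graph_dist G x u} = verts G - S"
    using S S' by (auto dest: less_asym)
  then show "n_closer G u v = card (verts G \<inter> S)" "n_closer G v u = card (verts G - S)"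
    by (simp_all add: n_closer_def)
qed

section \<open>Vertices and edges of the chain\<close>

lemma contact_simps [simp]:
  "contact n (i, 0) = (i, 0)" "contact n (i, 2) = (i, 2)" "contact n (i, 3) = (i, 3)"
  "contact n (i, Suc 0) = (if i < n then (Suc i, 0) else (i, Suc 0))"
  by (auto simp: contact_def)

text \<open>
  Indexing the edges by the sides of the disjoint squares turns sums over edges and degree
  counts into sums and counts over pairs, because identification merges no two edges.
\<close>
definition side :: "nat \<Rightarrow> nat \<times> nat \<Rightarrow> (nat \<times> nat) set" where
  "side n = (\<lambda>(i, j). {contact n (i, j), contact n (i, (j + 1) mod 4)})"

lemma side_simps [simp]:
  "side n (i, 0) = {(i, 0), contact n (i, 1)}"
  "side n (i, Suc 0) = {contact n (i, 1), (i, 2)}"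
  "side n (i, 2) = {(i, 2), (i, 3)}"
  "side n (i, 3) = {(i, 3), (i, 0)}"
  by (auto simp: side_def numeral_2_eq_2[symmetric])

lemma atLeastLessThan_0_4: "{0..<4} = {0, Suc 0, 2, 3}"
  by auto

lemma edges_ortho_chain: "edges (ortho_chain n) = side n ` ({1..n} \<times> {0..<4})"
proof -
  have "edges (ortho_chain n) =
      (\<lambda>e. contact n ` e) ` (\<lambda>(i, j). {(i, j), (i, (j + 1) mod 4)}) ` ({1..n} \<times> {0..<4})"
    unfolding ortho_chain_def image_graph_def disjoint_squares_def
    by (auto intro!: arg_cong[where f = "(`) (\<lambda>e. contact n ` e)"]) blast
  also have "\<dots> = side n ` ({1..n} \<times> {0..<4})"
    by (auto simp: image_image side_def intro!: image_cong)
  finally show ?thesis .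
qed

lemma verts_ortho_chain:
  assumes "n \<ge> 1"
  shows "verts (ortho_chain n) = insert (n, 1) ({1..n} \<times> {0, 2, 3})"
proof -
  have eq: "verts (ortho_chain n) = contact n ` ({1..n} \<times> {0, Suc 0, 2, 3})"
    unfolding ortho_chain_def image_graph_def disjoint_squares_def by (simp add: atLeastLessThan_0_4)
  show ?thesis
  proof
    show "verts (ortho_chain n) \<subseteq> insert (n, 1) ({1..n} \<times> {0, 2, 3})"
      unfolding eq by (auto split: if_splits)
    have "x = contact n x" if "x \<in> insert (n, 1) ({1..n} \<times> {0, 2, 3})" for x
      using that by auto
    moreover have "insert (n, 1) ({1..n} \<times> {0, 2, 3}) \<subseteq> {1..n} \<times> {0, Suc 0, 2, 3}"
      using assms by auto
    ultimately show "insert (n, 1) ({1..n} \<times> {0, 2, 3}) \<subseteq> verts (ortho_chain n)"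
      unfolding eq by blast
  qed
qed

lemma inj_on_side: "inj_on (side n) ({1..n} \<times> {0..<4})"
  unfolding atLeastLessThan_0_4
  by (rule inj_onI) (auto simp: doubleton_eq_iff split: if_splits)

lemma sides_are_edges:
  assumes "i \<in> {1..n}"
  shows "{(i, 0), contact n (i, 1)} \<in> edges (ortho_chain n)"
    "{contact n (i, 1), (i, 2)} \<in> edges (ortho_chain n)"
    "{(i, 2), (i, 3)} \<in> edges (ortho_chain n)"
    "{(i, 3), (i, 0)} \<in> edges (ortho_chain n)"
proof -
  have "side n (i, j) \<in> edges (ortho_chain n)" if "j < 4" for j
    using assms that unfolding edges_ortho_chain by auto
  from this[of 0] this[of 1] this[of 2] this[of 3] show
    "{(i, 0), contact n (i, 1)} \<in> edges (ortho_chain n)"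
    "{contact n (i, 1), (i, 2)} \<in> edges (ortho_chain n)"
    "{(i, 2), (i, 3)} \<in> edges (ortho_chain n)"
    "{(i, 3), (i, 0)} \<in> edges (ortho_chain n)"
    by simp_all
qed

lemma ortho_chain_edge_cases:
  assumes "{x, y} \<in> edges (ortho_chain n)"
    and sym: "\<And>x y. P x y \<Longrightarrow> P y x"
    and sides: "\<And>i. i \<in> {1..n} \<Longrightarrow> P (i, 0) (contact n (i, 1))"
      "\<And>i. i \<in> {1..n} \<Longrightarrow> P (contact n (i, 1)) (i, 2)"
      "\<And>i. i \<in> {1..n} \<Longrightarrow> P (i, 2) (i, 3)"
      "\<And>i. i \<in> {1..n} \<Longrightarrow> P (i, 3) (i, 0)"
  shows "P x y"
proof -
  from assms(1) obtain i j where ij: "i \<in> {1..n}" "j \<in> {0, Suc 0, 2, 3}" "{x, y} = side n (i, j)"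
    unfolding edges_ortho_chain atLeastLessThan_0_4 by blast
  have "P x y \<or> P y x"
    using ij(2,3) sides[OF ij(1)] by (auto simp: doubleton_eq_iff simp del: contact_simps)
  then show ?thesis using sym by blast
qed

lemma sum_edges_ortho_chain:
  "(\<Sum>e\<in>edges (ortho_chain n). f e) =
    (\<Sum>i=1..n. f {(i, 0), contact n (i, 1)} + f {contact n (i, 1), (i, 2)}
      + f {(i, 2), (i, 3)} + f {(i, 3), (i, 0)})"
proof -
  have "(\<Sum>e\<in>edges (ortho_chain n). f e) = (\<Sum>i=1..n. \<Sum>j\<in>{0..<4}. f (side n (i, j)))"
    unfolding edges_ortho_chain sum.reindex[OF inj_on_side] sum.cartesian_product
    by (simp add: case_prod_unfold)
  then show ?thesis
    by (simp add: atLeastLessThan_0_4 add_ac del: contact_simps)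
qed

lemma ortho_chain_connected:
  assumes n: "n \<ge> 1" and x: "x \<in> verts (ortho_chain n)" and y: "y \<in> verts (ortho_chain n)"
  shows "(x, y) \<in> (adj_rel (ortho_chain n))\<^sup>*"
proof -
  let ?A = "adj_rel (ortho_chain n)"
  have sym: "sym ?A" by (auto simp: sym_def adj_rel_def insert_commute)
  have step: "((i, 0), contact n (i, 1)) \<in> ?A" "((i, 0), (i, 3)) \<in> ?A" "((i, 3), (i, 2)) \<in> ?A"
    if "i \<in> {1..n}" for i
    using sides_are_edges[OF that] by (auto simp: adj_rel_def insert_commute)
  have path: "((1, 0), (i, 0)) \<in> ?A\<^sup>*" if "i \<in> {1..n}" for i
    using that
  proof (induction i)
    case (Suc i)
    show ?case
    proof (cases "i = 0")
      case False
      then have "((i, 0), (Suc i, 0)) \<in> ?A" using step(1)[of i] Suc.prems by auto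
      then show ?thesis using Suc False by (auto intro: rtrancl.rtrancl_into_rtrancl)
    qed simp
  qed simp
  have root: "((1, 0), z) \<in> ?A\<^sup>*" if "z \<in> verts (ortho_chain n)" for z
  proof -
    from that obtain i where i: "i \<in> {1..n}"
      "z = (i, 0) \<or> z = contact n (i, 1) \<or> z = (i, 3) \<or> z = (i, 2)"
      using n unfolding verts_ortho_chain[OF n] by fastforce
    then show ?thesis using path[OF i(1)] step[OF i(1)]
      by (auto intro: rtrancl.rtrancl_into_rtrancl simp del: contact_simps)
  qed
  have "(x, (1, 0)) \<in> ?A\<^sup>*" using root[OF x] sym_rtrancl[OF sym] by (auto dest: symD)
  then show ?thesis using root[OF y] by (rule rtrancl_trans)
qed

section \<open>The Graovac--Ghorbani index\<close>

text \<open>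
  The vertices to the left of the cut through the \<open>i\<close>-th bottom and top sides. A
  contact vertex carries the coordinates of the square to its right, so the condition on
  coordinates is the same in every square.
\<close>
definition left_part :: "nat \<Rightarrow> (nat \<times> nat) set" where
  "left_part i = {(c, j). c < i \<or> c = i \<and> j \<in> {0, 3}}"

lemma ortho_chain_folds_onto:
  fixes n :: nat and S :: "(nat \<times> nat) set" and r :: "nat \<times> nat \<Rightarrow> nat \<times> nat"
  defines "P \<equiv> \<lambda>x y. r x = r y \<or> ({r x, r y} \<in> edges (ortho_chain n) \<and> (x \<in> S \<longleftrightarrow> y \<in> S))"
  assumes "\<And>x. x \<in> S \<Longrightarrow> r x = x"
    and "\<And>i. i \<in> {1..n} \<Longrightarrow> P (i, 0) (contact n (i, 1))"
      "\<And>i. i \<in> {1..n} \<Longrightarrow> P (contact n (i, 1)) (i, 2)"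
      "\<And>i. i \<in> {1..n} \<Longrightarrow> P (i, 2) (i, 3)"
      "\<And>i. i \<in> {1..n} \<Longrightarrow> P (i, 3) (i, 0)"
  shows "folds_onto (ortho_chain n) S r"
proof -
  have "P x y \<Longrightarrow> P y x" for x y
    by (auto simp: P_def insert_commute)
  then have "P x y" if "{x, y} \<in> edges (ortho_chain n)" for x y
    by (rule ortho_chain_edge_cases[OF that, where P = P, OF _ assms(3-6)])
  then show ?thesis using assms(2) by (auto simp: folds_onto_def P_def)
qed

text \<open>
  The edges of one square with contact vertices resolved into coordinates, in both
  orientations, for use as rewrite rules.
\<close>
lemma coordinate_edges:
  assumes "Suc 0 \<le> i" "i \<le> n"
  shows "{(i, 2), (i, 3)} \<in> edges (ortho_chain n)" "{(i, 3), (i, 2)} \<in> edges (ortho_chain n)"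
    "{(i, 3), (i, 0)} \<in> edges (ortho_chain n)" "{(i, 0), (i, 3)} \<in> edges (ortho_chain n)"
    "i < n \<Longrightarrow> {(i, 0), (Suc i, 0)} \<in> edges (ortho_chain n)"
    "i < n \<Longrightarrow> {(Suc i, 0), (i, 2)} \<in> edges (ortho_chain n)"
    "i = n \<Longrightarrow> {(i, 0), (i, Suc 0)} \<in> edges (ortho_chain n)"
    "i = n \<Longrightarrow> {(i, Suc 0), (i, 2)} \<in> edges (ortho_chain n)"
    "i < n \<Longrightarrow> {(Suc i, 0), (i, 0)} \<in> edges (ortho_chain n)"
    "i < n \<Longrightarrow> {(i, 2), (Suc i, 0)} \<in> edges (ortho_chain n)"
    "i = n \<Longrightarrow> {(i, Suc 0), (i, 0)} \<in> edges (ortho_chain n)"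
    "i = n \<Longrightarrow> {(i, 2), (i, Suc 0)} \<in> edges (ortho_chain n)"
  using sides_are_edges[of i n] assms by (auto simp: insert_commute)

context
  fixes n i :: nat
  assumes i: "i \<in> {1..n}"
begin

text \<open>
  Everything beyond the \<open>i\<close>-th square hangs on \<open>p\<^sub>i\<close>, so it may follow that vertex when
  the \<open>i\<close>-th square is flattened onto its left side. The next fold is the mirror image. Of
  the last two, one flattens the square onto its bottom side and fixes the rest of the
  chain, the other flattens it onto its top side, where each half of the chain follows the
  corner on which it hangs.
\<close>
lemma fold_onto_left:
  "folds_onto (ortho_chain n) (left_part i)
     (\<lambda>x. if x \<in> left_part i then x else if x = (i, 2) then (i, 3) else (i, 0))"
  using i by (intro ortho_chain_folds_onto) (auto simp: left_part_def coordinate_edges)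

lemma fold_onto_right:
  "folds_onto (ortho_chain n) (- left_part i)
     (\<lambda>x. if x \<notin> left_part i then x else if x = (i, 3) then (i, 2) else contact n (i, 1))"
  using i by (intro ortho_chain_folds_onto) (auto simp: left_part_def coordinate_edges)

lemma fold_off_square:
  "folds_onto (ortho_chain n) (- {(i, 2), (i, 3)})
     (\<lambda>x. if x = (i, 2) then contact n (i, 1) else if x = (i, 3) then (i, 0) else x)"
  using i by (intro ortho_chain_folds_onto) (auto simp: coordinate_edges)

lemma fold_onto_square:
  "folds_onto (ortho_chain n) {(i, 2), (i, 3)}
     (\<lambda>x. if x \<in> left_part i then (i, 3) else (i, 2))"
  using i by (intro ortho_chain_folds_onto) (auto simp: left_part_def coordinate_edges)

lemma square_verts:
  "(i, 0) \<in> verts (ortho_chain n)" "contact n (i, 1) \<in> verts (ortho_chain n)"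
  "(i, 2) \<in> verts (ortho_chain n)" "(i, 3) \<in> verts (ortho_chain n)"
  using i by (auto simp: verts_ortho_chain)

lemma card_verts_Int_left_part: "card (verts (ortho_chain n) \<inter> left_part i) = 3 * i - 1"
proof -
  have "verts (ortho_chain n) \<inter> left_part i = {1..<i} \<times> {0, 2, 3} \<union> {i} \<times> {0, 3}"
    using i by (auto simp: verts_ortho_chain left_part_def)
  also have "card \<dots> = 3 * (i - 1) + 2"
    by (subst card_Un_disjoint) (auto simp: card_cartesian_product)
  also have "\<dots> = 3 * i - 1" using i by auto
  finally show ?thesis .
qed

lemma card_verts: "card (verts (ortho_chain n)) = 3 * n + 1"
proof -
  have "card (verts (ortho_chain n)) = Suc (card ({1..n} \<times> {0::nat, 2, 3}))"
    using i by (subst verts_ortho_chain) (auto intro: card_insert_disjoint)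
  then show ?thesis by (simp add: card_cartesian_product)
qed

lemma finite_verts: "finite (verts (ortho_chain n))"
  using finite_simple_graph_ortho_chain by (simp add: finite_simple_graph_def)

lemma card_verts_diff_left_part: "card (verts (ortho_chain n) - left_part i) = 3 * n - 3 * i + 2"
proof -
  have "card (verts (ortho_chain n) - left_part i)
      = card (verts (ortho_chain n)) - card (verts (ortho_chain n) \<inter> left_part i)"
    using finite_verts by (simp add: card_Diff_subset_Int)
  then show ?thesis
    using i by (auto simp: card_verts card_verts_Int_left_part)
qed

lemma n_closer_parallel:
  "n_closer (ortho_chain n) (i, 0) (contact n (i, 1)) = 3 * i - 1"
  "n_closer (ortho_chain n) (contact n (i, 1)) (i, 0) = 3 * n - 3 * i + 2"
  "n_closer (ortho_chain n) (i, 3) (i, 2) = 3 * i - 1"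
  "n_closer (ortho_chain n) (i, 2) (i, 3) = 3 * n - 3 * i + 2"
proof -
  have n: "n \<ge> 1" using i by auto
  note closer = n_closer_of_folds[OF ortho_chain_connected[OF n] fold_onto_left fold_onto_right,
      unfolded card_verts_Int_left_part card_verts_diff_left_part]
  show "n_closer (ortho_chain n) (i, 0) (contact n (i, 1)) = 3 * i - 1"
    "n_closer (ortho_chain n) (contact n (i, 1)) (i, 0) = 3 * n - 3 * i + 2"
    by (rule closer; use square_verts i in \<open>auto simp: left_part_def split: if_splits\<close>)+
  show "n_closer (ortho_chain n) (i, 3) (i, 2) = 3 * i - 1"
    "n_closer (ortho_chain n) (i, 2) (i, 3) = 3 * n - 3 * i + 2"
    by (rule closer; use square_verts i in \<open>auto simp: left_part_def split: if_splits\<close>)+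
qed

lemma n_closer_transverse:
  "n_closer (ortho_chain n) (i, 3) (i, 0) = 2"
  "n_closer (ortho_chain n) (i, 0) (i, 3) = 3 * n - 1"
  "n_closer (ortho_chain n) (i, 2) (contact n (i, 1)) = 2"
  "n_closer (ortho_chain n) (contact n (i, 1)) (i, 2) = 3 * n - 1"
proof -
  have n: "n \<ge> 1" using i by auto
  have Int: "verts (ortho_chain n) \<inter> {(i, 2), (i, 3)} = {(i, 2), (i, 3)}"
    using square_verts by auto
  have card: "card (verts (ortho_chain n) \<inter> {(i, 2), (i, 3)}) = 2"
    unfolding Int by simp
  have card': "card (verts (ortho_chain n) - {(i, 2), (i, 3)}) = 3 * n - 1"
    using finite_verts Int by (simp add: card_Diff_subset_Int card_verts)
  note closer = n_closer_of_folds[OF ortho_chain_connected[OF n] fold_onto_square fold_off_square, unfolded card card']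
  show "n_closer (ortho_chain n) (i, 3) (i, 0) = 2"
    "n_closer (ortho_chain n) (i, 0) (i, 3) = 3 * n - 1"
    by (rule closer; use square_verts i in \<open>auto simp: left_part_def split: if_splits\<close>)+
  show "n_closer (ortho_chain n) (i, 2) (contact n (i, 1)) = 2"
    "n_closer (ortho_chain n) (contact n (i, 1)) (i, 2) = 3 * n - 1"
    by (rule closer; use square_verts i in \<open>auto simp: left_part_def split: if_splits\<close>)+
qed

end

text \<open>
  The reason why most edges contribute \<open>1 / sqrt 2\<close>: if one of the two numbers is 2, it
  cancels against the 2 in the numerator, and the other number drops out of the quotient.
\<close>
lemma sqrt_summand_two:
  fixes d :: real
  assumes "d > 0"
  shows "sqrt ((2 + d - 2) / (2 * d)) = sqrt 2 / 2" "sqrt ((d + 2 - 2) / (d * 2)) = sqrt 2 / 2"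
proof -
  have "sqrt (1 / 2) = sqrt 2 / 2"
    by (simp add: real_sqrt_divide real_div_sqrt field_simps)
  then show "sqrt ((2 + d - 2) / (2 * d)) = sqrt 2 / 2" "sqrt ((d + 2 - 2) / (d * 2)) = sqrt 2 / 2"
    using assms by simp_all
qed

text \<open>
  The contribution of an edge across the cut bounding \<open>left_part i\<close>. The numerator is the
  same for all \<open>i\<close> because each of the \<open>3n + 1\<close> vertices is on one of the two sides.
\<close>
definition cut_term :: "nat \<Rightarrow> nat \<Rightarrow> real" where
  "cut_term n i =
     sqrt ((3 * real n - 1) / ((3 * real n - 3 * real i + 2) * (3 * real i - 1)))"

lemma ABC_GG_ortho_chain:
  "ABC_GG (ortho_chain n) = real n * sqrt 2 + 2 * (\<Sum>i=1..n. cut_term n i)"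
proof -
  let ?G = "ortho_chain n"
  let ?f = "\<lambda>e. sqrt (((\<Sum>u\<in>e. \<Sum>v\<in>e - {u}. real (n_closer ?G u v)) - 2) /
           (\<Prod>u\<in>e. \<Prod>v\<in>e - {u}. real (n_closer ?G u v)))"
  have "?f {(i, 0), contact n (i, 1)} + ?f {contact n (i, 1), (i, 2)}
      + ?f {(i, 2), (i, 3)} + ?f {(i, 3), (i, 0)} = sqrt 2 + 2 * cut_term n i"
    if i: "i \<in> {1..n}" for i
  proof -
    have neq: "(i, 0) \<noteq> contact n (i, 1)" "contact n (i, 1) \<noteq> (i, 2)"
      "(i, 2) \<noteq> (i, 3::nat)" "(i, 3) \<noteq> (i, 0::nat)"
      by auto
    have real: "real (3 * i - 1) = 3 * real i - 1" "real (3 * n - 1) = 3 * real n - 1"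
      "real (3 * n - 3 * i + 2) = 3 * real n - 3 * real i + 2"
      using i by (auto simp: of_nat_diff)
    have f: "?f {(i, 0), contact n (i, 1)} = cut_term n i"
      "?f {(i, 2), (i, 3)} = cut_term n i"
      unfolding ABC_GG_summand[OF neq(1) refl] ABC_GG_summand[OF neq(3) refl]
        n_closer_parallel[OF i] real cut_term_def
      by (simp_all add: mult.commute)
    have "?f {contact n (i, 1), (i, 2)} = sqrt 2 / 2" "?f {(i, 3), (i, 0)} = sqrt 2 / 2"
      using i sqrt_summand_two[of "3 * real n - 1"]
      unfolding ABC_GG_summand[OF neq(2) refl] ABC_GG_summand[OF neq(4) refl]
        n_closer_transverse[OF i] real of_nat_numeral
      by auto
    with f show ?thesis by simp
  qed
  then have "ABC_GG ?G = (\<Sum>i=1..n. sqrt 2 + 2 * cut_term n i)"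
    unfolding ABC_GG_def sum_edges_ortho_chain by (intro sum.cong) auto
  then show ?thesis by (simp add: sum.distrib sum_distrib_left)
qed

lemma sum_palindrome:
  fixes f :: "nat \<Rightarrow> 'a::comm_semiring_1"
  assumes "\<And>i. i \<in> {1..n} \<Longrightarrow> f (n + 1 - i) = f i"
  shows "n = 2 * k \<Longrightarrow> (\<Sum>i=1..n. f i) = 2 * (\<Sum>i=1..k. f i)"
    and "n = 2 * k + 1 \<Longrightarrow> (\<Sum>i=1..n. f i) = f (k + 1) + 2 * (\<Sum>i=1..k. f i)"
proof -
  have upper: "(\<Sum>i=n+1-k..n. f i) = (\<Sum>i=1..k. f i)" if "n \<ge> 2 * k"
    using that assms
    by (intro sum.reindex_bij_witness[of _ "\<lambda>i. n + 1 - i" "\<lambda>i. n + 1 - i"]) auto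
  show "(\<Sum>i=1..n. f i) = 2 * (\<Sum>i=1..k. f i)" if n: "n = 2 * k"
  proof -
    have "{1..n} = {1..k} \<union> {n+1-k..n}" using n by auto
    then have "(\<Sum>i=1..n. f i) = (\<Sum>i=1..k. f i) + (\<Sum>i=n+1-k..n. f i)"
      using n by (simp add: sum.union_disjoint)
    then show ?thesis using upper n by (simp add: mult_2)
  qed
  show "(\<Sum>i=1..n. f i) = f (k + 1) + 2 * (\<Sum>i=1..k. f i)" if n: "n = 2 * k + 1"
  proof -
    have "{1..n} = insert (k + 1) ({1..k} \<union> {n+1-k..n})" using n by auto
    then have "(\<Sum>i=1..n. f i) = f (k + 1) + ((\<Sum>i=1..k. f i) + (\<Sum>i=n+1-k..n. f i))"
      using n by (simp add: sum.union_disjoint)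
    then show ?thesis using upper n by (simp add: mult_2)
  qed
qed

lemma cut_term_reflect: "i \<in> {1..n} \<Longrightarrow> cut_term n (n + 1 - i) = cut_term n i"
  by (simp add: cut_term_def of_nat_diff algebra_simps)

section \<open>The atom-bond connectivity index\<close>

lemma degree_ortho_chain:
  "degree (ortho_chain n) u = card {p \<in> {1..n} \<times> {0..<4}. u \<in> side n p}"
proof -
  have "{e \<in> edges (ortho_chain n). u \<in> e} = side n ` {p \<in> {1..n} \<times> {0..<4}. u \<in> side n p}"
    by (auto simp: edges_ortho_chain)
  then show ?thesis
    unfolding degree_def by (simp add: card_image inj_on_subset[OF inj_on_side])
qed

text \<open>
  The vertex \<open>(i, 0)\<close> lies on two sides of its own square and, unless it is the free end
  \<open>p\<^sub>0\<close>, on two sides of the square before it. The other free end \<open>p\<^sub>n\<close> is the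
  only vertex with second coordinate 1.
\<close>
lemma degree_ortho_chain_vertices:
  assumes i: "i \<in> {1..n}"
  shows "degree (ortho_chain n) (i, 2) = 2" "degree (ortho_chain n) (i, 3) = 2"
    "degree (ortho_chain n) (i, 0) = (if i = 1 then 2 else 4)"
    "degree (ortho_chain n) (n, Suc 0) = 2"
proof -
  have sides: "{p \<in> {1..n} \<times> {0..<4}. (i, 2) \<in> side n p} = {i} \<times> {1, 2}"
    "{p \<in> {1..n} \<times> {0..<4}. (i, 3) \<in> side n p} = {i} \<times> {2, 3}"
    "{p \<in> {1..n} \<times> {0..<4}. (i, 0) \<in> side n p}
      = {i} \<times> {0, 3} \<union> (if i = 1 then {} else {i - 1} \<times> {0, 1})"
    "{p \<in> {1..n} \<times> {0..<4}. (n, Suc 0) \<in> side n p} = {n} \<times> {0, 1}"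
    using i unfolding atLeastLessThan_0_4 by (auto split: if_splits)
  show "degree (ortho_chain n) (i, 2) = 2" "degree (ortho_chain n) (i, 3) = 2"
    "degree (ortho_chain n) (i, 0) = (if i = 1 then 2 else 4)"
    "degree (ortho_chain n) (n, Suc 0) = 2"
    using i unfolding degree_ortho_chain sides by (auto simp: card_insert_if)
qed

lemma ABC_ortho_chain:
  assumes "n \<ge> 2"
  shows "ABC (ortho_chain n) = (3 * real n + 2) / sqrt 2 + (real n - 2) * sqrt 6 / 4"
proof -
  let ?G = "ortho_chain n"
  let ?f = "\<lambda>e. sqrt (((\<Sum>u\<in>e. real (degree ?G u)) - 2) / (\<Prod>u\<in>e. real (degree ?G u)))"
  \<comment> \<open>The contribution of the \<open>i\<close>-th backbone edge, which has a free end iff \<open>i\<close> is 1 or \<open>n\<close>.\<close>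
  let ?g = "\<lambda>i. if i \<in> {1, n} then sqrt 2 / 2 else sqrt 6 / 4"
  have "?f {(i, 0), contact n (i, 1)} + ?f {contact n (i, 1), (i, 2)}
      + ?f {(i, 2), (i, 3)} + ?f {(i, 3), (i, 0)} = 3 * (sqrt 2 / 2) + ?g i"
    if i: "i \<in> {1..n}" for i
  proof -
    have neq: "(i, 0) \<noteq> contact n (i, 1)" "contact n (i, 1) \<noteq> (i, 2)"
      "(i, 2) \<noteq> (i, 3::nat)" "(i, 3) \<noteq> (i, 0::nat)"
      by auto
    have contact: "degree ?G (contact n (i, 1)) = (if i = n then 2 else 4)"
      using i degree_ortho_chain_vertices[of "Suc i" n] degree_ortho_chain_vertices[OF i] by auto
    have "sqrt (6 / 4\<^sup>2) = sqrt 6 / 4" by (simp only: real_sqrt_divide real_sqrt_abs)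
    then have "?f {(i, 0), contact n (i, 1)} = ?g i"
      using assms sqrt_summand_two[of 2] sqrt_summand_two[of 4]
      unfolding ABC_summand[OF neq(1) refl] contact degree_ortho_chain_vertices[OF i] by auto
    moreover have "?f {contact n (i, 1), (i, 2)} = sqrt 2 / 2"
      using sqrt_summand_two[of 2] sqrt_summand_two[of 4]
      unfolding ABC_summand[OF neq(2) refl] contact degree_ortho_chain_vertices[OF i] by auto
    moreover have "?f {(i, 2), (i, 3)} = sqrt 2 / 2"
      using sqrt_summand_two[of 2]
      unfolding ABC_summand[OF neq(3) refl] degree_ortho_chain_vertices[OF i] by auto
    moreover have "?f {(i, 3), (i, 0)} = sqrt 2 / 2"
      using sqrt_summand_two[of 2] sqrt_summand_two[of 4]
      unfolding ABC_summand[OF neq(4) refl] degree_ortho_chain_vertices[OF i] by auto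
    ultimately show ?thesis by simp
  qed
  then have "ABC ?G = (\<Sum>i=1..n. 3 * (sqrt 2 / 2) + ?g i)"
    unfolding ABC_def sum_edges_ortho_chain by (intro sum.cong) auto
  also have "\<dots> = real n * (3 * (sqrt 2 / 2)) + (\<Sum>i=1..n. ?g i)"
    by (simp add: sum.distrib)
  also have "(\<Sum>i=1..n. ?g i) = 2 * (sqrt 2 / 2) + (real n - 2) * (sqrt 6 / 4)"
  proof -
    have "{1..n} = insert 1 (insert n {2..<n})" using assms by auto
    \<comment> \<open>The two end terms are distinct because \<open>n \<ge> 2\<close>.\<close>
    then have "(\<Sum>i=1..n. ?g i) = sqrt 2 / 2 + (sqrt 2 / 2 + (\<Sum>i=2..<n. ?g i))"
      using assms by simp
    also have "(\<Sum>i=2..<n. ?g i) = (\<Sum>i=2..<n. sqrt 6 / 4)"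
      by (intro sum.cong) auto
    finally show ?thesis using assms by (simp add: of_nat_diff)
  qed
  also have "sqrt 2 / 2 = 1 / sqrt 2"
    by (simp add: field_simps)
  finally show ?thesis by (simp add: field_simps)
qed

theorem theorem3p5:
  "(\<forall>n k :: nat. n \<ge> 2 \<longrightarrow> k \<ge> 1 \<longrightarrow>
      (n = 2 * k \<longrightarrow>
        ABC_GG (ortho_chain n) =
          2 * real k * sqrt 2 +
          4 * (\<Sum>i = 1..k. sqrt ((6 * real k - 1) /
                ((6 * real k - 3 * real i + 2) * (3 * real i - 1))))) \<and>
      (n = 2 * k + 1 \<longrightarrow>
        ABC_GG (ortho_chain n) =
          (2 * real k + 1) * sqrt 2 +
          2 * sqrt (6 * real k + 2) / (3 * real k + 2) +
          4 * (\<Sum>i = 1..k. sqrt ((6 * real k + 2) /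
                ((6 * real k - 3 * real i + 5) * (3 * real i - 1)))))) \<and>
   (\<forall>n :: nat. n \<ge> 2 \<longrightarrow>
      ABC (ortho_chain n) =
        (3 * real n + 2) / sqrt 2 + (real n - 2) * sqrt 6 / 4)"
proof (intro conjI allI impI)
  fix n k :: nat
  assume n: "n = 2 * k"
  have "(\<Sum>i=1..n. cut_term n i) = 2 * (\<Sum>i=1..k. cut_term n i)"
    using n by (intro sum_palindrome(1) cut_term_reflect) auto
  then show "ABC_GG (ortho_chain n) =
          2 * real k * sqrt 2 +
          4 * (\<Sum>i = 1..k. sqrt ((6 * real k - 1) /
                ((6 * real k - 3 * real i + 2) * (3 * real i - 1))))"
    using n by (simp add: ABC_GG_ortho_chain cut_term_def)
next
  fix n k :: nat
  assume n: "n = 2 * k + 1"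
  have "(\<Sum>i=1..n. cut_term n i) = cut_term n (k + 1) + 2 * (\<Sum>i=1..k. cut_term n i)"
    using n by (intro sum_palindrome(2) cut_term_reflect) auto
  \<comment> \<open>The middle cut has \<open>3k + 2\<close> vertices on both sides, so the square root of the denominator
    resolves.\<close>
  moreover have "cut_term n (k + 1) = sqrt (6 * real k + 2) / (3 * real k + 2)"
    using n by (simp add: cut_term_def real_sqrt_divide algebra_simps flip: power2_eq_square)
  moreover have "cut_term n i = sqrt ((6 * real k + 2) /
                ((6 * real k - 3 * real i + 5) * (3 * real i - 1)))" for i
    using n by (simp add: cut_term_def algebra_simps)
  ultimately show "ABC_GG (ortho_chain n) =
          (2 * real k + 1) * sqrt 2 +
          2 * sqrt (6 * real k + 2) / (3 * real k + 2) +
          4 * (\<Sum>i = 1..k. sqrt ((6 * real k + 2) /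
                ((6 * real k - 3 * real i + 5) * (3 * real i - 1))))"
    using n by (simp add: ABC_GG_ortho_chain algebra_simps)
next
  fix n :: nat
  assume "n \<ge> 2"
  then show "ABC (ortho_chain n) =
        (3 * real n + 2) / sqrt 2 + (real n - 2) * sqrt 6 / 4"
    by (rule ABC_ortho_chain)
qed

end
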